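(* Let $R$ be a commutative ring with identity, $M$ a unital $R$-module, $S$ a commutative, cancellative and torsion-free monoid, and $n$ a positive integer. Then the $R[S]$-module $M[S]$ has few zero-divisors of size $n$ if and only if the $R$-module $M$ has few zero-divisors of size $n$ and has Property (A).
   Context: The monoid $S$ is written additively; cancellative means $s+t=s+u$ implies $t=u$; torsion-free means that $ks=kt$ for some integer $k\ge 1$ implies $s=t$ ($s,t,u\in S$). $R[S]$ is the semigroup ring. $M[S]$ is the semigroup module: the set of formal finite sums $m_1X^{s_1}+\cdots+m_rX^{s_r}$ with $m_i\in M$ and distinct $s_i\in S$, with coefficientwise addition, and with the $R[S]$-action determined by $(aX^s)(mX^t)=(am)X^{s+t}$ for $a\in R$, $m\in M$, $s,t\in S$. For a module $N$ over a commutative ring $A$, $Z_A(N)=\{a\in A : ax=0 \text{ for some } x\in N\setminus\{0\}\}$ is the set of zero-divisors of $N$. The $A$-module $N$ has few zero-divisors of size $n$ if $Z_A(N)$ is the union of $n$ prime ideals $\mathbf{p}_1,\ldots,\mathbf{p}_n$ of $A$ such that $\mathbf{p}_i\nsubseteq \mathbf{p}_j$ for all $i\neq j$. The $A$-module $N$ has Property (A) if each finitely generated ideal $I$ of $A$ with $I\subseteq Z_A(N)$ has a nonzero annihilator in $N$, i.e. there is $x\in N\setminus\{0\}$ with $Ix=0$.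
   Formalization: The monoid S is additionally assumed to be nontrivial (S ≠ {0}); for S = {0} the claim is false, e.g. R = k[[x,y]] and M the direct sum of R/p over all height-one primes p, which has few zero-divisors of size 1 but not Property (A). *)

theory Defs
  imports Complex_Main "HOL-Library.Poly_Mapping"
begin

text \<open>
  The sort \<open>{comm_ring, comm_monoid_mult}\<close> describes commutative rings with identity, including the
  zero ring; the class \<open>comm_ring_1\<close> and the library locale \<open>module\<close> built on it would require
  \<open>0 \<noteq> 1\<close>. The lemma below the locale shows that this is the only difference.
\<close>

locale unital_module =
  fixes scale :: "'a::{comm_ring, comm_monoid_mult} \<Rightarrow> 'm::ab_group_add \<Rightarrow> 'm"
  assumes scale_right_distrib: "scale a (x + y) = scale a x + scale a y"
    and scale_left_distrib: "scale (a + b) x = scale a x + scale b x"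
    and scale_scale: "scale a (scale b x) = scale (a * b) x"
    and scale_one: "scale 1 x = x"

lemma unital_module_iff_module:
  fixes scale :: "'a::comm_ring_1 \<Rightarrow> 'm::ab_group_add \<Rightarrow> 'm"
  shows "unital_module scale \<longleftrightarrow> module scale"
  unfolding unital_module_def module_def by auto

text \<open>
  The remaining ring-theoretic notions are stated for \<open>comm_ring\<close>, because the semigroup ring
  \<open>'s \<Rightarrow>\<^sub>0 'r\<close> is available as an instance of \<open>comm_ring\<close> over every \<open>'r::comm_ring\<close>, whereas its
  library instance with \<open>1\<close> needs \<open>0 \<noteq> 1\<close> in \<open>'r\<close>.
\<close>

definition is_ideal :: "'a::comm_ring set \<Rightarrow> bool" where
  "is_ideal I \<longleftrightarrow>
     0 \<in> I \<and> (\<forall>x\<in>I. \<forall>y\<in>I. x - y \<in> I) \<and> (\<forall>a. \<forall>x\<in>I. a * x \<in> I)"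

definition is_prime_ideal :: "'a::comm_ring set \<Rightarrow> bool" where
  "is_prime_ideal P \<longleftrightarrow>
     is_ideal P \<and> P \<noteq> UNIV \<and> (\<forall>a b. a * b \<in> P \<longrightarrow> a \<in> P \<or> b \<in> P)"

definition is_fg_ideal :: "'a::comm_ring set \<Rightarrow> bool" where
  "is_fg_ideal I \<longleftrightarrow> (\<exists>F. finite F \<and> I = is_ideal hull F)"

definition zero_divisors :: "('a::comm_ring \<Rightarrow> 'm::ab_group_add \<Rightarrow> 'm) \<Rightarrow> 'a set" where
  "zero_divisors scale = {a. \<exists>x. x \<noteq> 0 \<and> scale a x = 0}"

definition few_zero_divisors :: "('a::comm_ring \<Rightarrow> 'm::ab_group_add \<Rightarrow> 'm) \<Rightarrow> nat \<Rightarrow> bool" where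
  "few_zero_divisors scale n \<longleftrightarrow>
     (\<exists>p :: nat \<Rightarrow> 'a set.
        (\<forall>i\<in>{1..n}. is_prime_ideal (p i)) \<and>
        (\<forall>i\<in>{1..n}. \<forall>j\<in>{1..n}. i \<noteq> j \<longrightarrow> \<not> p i \<subseteq> p j) \<and>
        zero_divisors scale = (\<Union>i\<in>{1..n}. p i))"

definition property_A :: "('a::comm_ring \<Rightarrow> 'm::ab_group_add \<Rightarrow> 'm) \<Rightarrow> bool" where
  "property_A scale \<longleftrightarrow>
     (\<forall>I. is_fg_ideal I \<and> I \<subseteq> zero_divisors scale \<longrightarrow>
        (\<exists>x. x \<noteq> 0 \<and> (\<forall>a\<in>I. scale a x = 0)))"

text \<open>
  \<open>R[S]\<close> is the type \<open>'s \<Rightarrow>\<^sub>0 'r\<close> with the convolution product of \<open>Poly_Mapping\<close>, and \<open>M[S]\<close> is the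
  type \<open>'s \<Rightarrow>\<^sub>0 'm\<close>; the monomial \<open>m X\<^sup>s\<close> is \<open>Poly_Mapping.single s m\<close>.
\<close>

definition semigroup_scale ::
  "('r::comm_ring \<Rightarrow> 'm::ab_group_add \<Rightarrow> 'm) \<Rightarrow>
     ('s::comm_monoid_add \<Rightarrow>\<^sub>0 'r) \<Rightarrow> ('s \<Rightarrow>\<^sub>0 'm) \<Rightarrow> ('s \<Rightarrow>\<^sub>0 'm)" where
  "semigroup_scale scale f g =
     (\<Sum>s\<in>Poly_Mapping.keys f. \<Sum>t\<in>Poly_Mapping.keys g.
        Poly_Mapping.single (s + t) (scale (Poly_Mapping.lookup f s) (Poly_Mapping.lookup g t)))"

context unital_module
begin

lemma scale_zero_left [simp]: "scale 0 x = 0"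
  using scale_left_distrib[of 0 0 x] by simp

lemma scale_zero_right [simp]: "scale a 0 = 0"
  using scale_right_distrib[of a 0 0] by simp

lemma semigroup_scale_superset:
  assumes "finite A" "Poly_Mapping.keys f \<subseteq> A" "finite B" "Poly_Mapping.keys g \<subseteq> B"
  shows "semigroup_scale scale f g =
     (\<Sum>s\<in>A. \<Sum>t\<in>B.
        Poly_Mapping.single (s + t) (scale (Poly_Mapping.lookup f s) (Poly_Mapping.lookup g t)))"
proof -
  have "(\<Sum>t\<in>Poly_Mapping.keys g.
        Poly_Mapping.single (s + t) (scale (Poly_Mapping.lookup f s) (Poly_Mapping.lookup g t))) =
      (\<Sum>t\<in>B.
        Poly_Mapping.single (s + t) (scale (Poly_Mapping.lookup f s) (Poly_Mapping.lookup g t)))" for s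
    by (rule sum.mono_neutral_left) (use assms in \<open>auto simp: in_keys_iff\<close>)
  then show ?thesis
    unfolding semigroup_scale_def
    by (simp, intro sum.mono_neutral_left) (use assms in \<open>auto simp: in_keys_iff\<close>)
qed

lemma semigroup_scale_single:
  "semigroup_scale scale (Poly_Mapping.single s a) (Poly_Mapping.single t x) =
     Poly_Mapping.single (s + t) (scale a x)"
  by (subst semigroup_scale_superset[of "{s}" _ "{t}"]) auto

lemma semigroup_scale_add_left:
  "semigroup_scale scale (f + f') g = semigroup_scale scale f g + semigroup_scale scale f' g"
proof -
  let ?A = "Poly_Mapping.keys f \<union> Poly_Mapping.keys f'" and ?B = "Poly_Mapping.keys g"
  have "Poly_Mapping.keys (f + f') \<subseteq> ?A" by (rule keys_add)
  then show ?thesis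
    by (simp add: semigroup_scale_superset[of ?A _ ?B] lookup_add scale_left_distrib
        single_add sum.distrib)
qed

lemma semigroup_scale_add_right:
  "semigroup_scale scale f (g + g') = semigroup_scale scale f g + semigroup_scale scale f g'"
proof -
  let ?A = "Poly_Mapping.keys f" and ?B = "Poly_Mapping.keys g \<union> Poly_Mapping.keys g'"
  have "Poly_Mapping.keys (g + g') \<subseteq> ?B" by (rule keys_add)
  then show ?thesis
    by (simp add: semigroup_scale_superset[of ?A _ ?B] lookup_add scale_right_distrib
        single_add sum.distrib)
qed

end

end

theory Submission
  imports Defs
begin

text \<open>
  The link between the two modules is McCoy's theorem for \<open>M[S]\<close>: an element of \<open>R[S]\<close> is a
  zero-divisor of \<open>M[S]\<close> exactly when all its coefficients annihilate one and the same nonzero element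
  of \<open>M\<close> (\<open>zero_divisors_semigroup_scale_iff\<close>). Thus membership in \<open>Z(M[S])\<close> is a statement about
  the ideal of \<open>R\<close> generated by the coefficients, and it is Property (A) that says that such a finitely
  generated ideal is annihilated by a nonzero element as soon as it consists of zero-divisors of \<open>M\<close>.

  The prime ideals are moved between \<open>R\<close> and \<open>R[S]\<close> by the extension \<open>P[S]\<close>, the set of elements
  with all coefficients in \<open>P\<close>, and by contraction. If \<open>M\<close> has Property (A) and \<open>Z(M)\<close> is the union of
  finitely many primes \<open>p\<^sub>i\<close>, then \<open>Z(M[S])\<close> is the union of the primes \<open>p\<^sub>i[S]\<close>
  (\<open>zero_divisors_semigroup_scale\<close>): for one inclusion, prime avoidance puts the coefficient ideal
  into a single \<open>p\<^sub>i\<close>; the other is Property (A). Since extension preserves and reflects inclusion,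
  incomparable primes stay incomparable.

  Conversely, let \<open>Z(M[S])\<close> be the union of incomparable primes \<open>q\<^sub>i\<close>, with contractions \<open>p\<^sub>i\<close>. Then
  \<open>Z(M)\<close> is the union of the \<open>p\<^sub>i\<close>, and a finitely generated ideal of zero-divisors lies in
  some \<open>p\<^sub>i\<close>. As \<open>S\<close> is infinite, its generators are the coefficients of one element, which lies in
  \<open>q\<^sub>i\<close>, and McCoy's theorem yields Property (A)
  (\<open>property_A_if_zero_divisors_semigroup_scale\<close>). Now also \<open>Z(M[S])\<close> is the union of the
  \<open>p\<^sub>i[S]\<close>, where \<open>p\<^sub>i[S] \<subseteq> q\<^sub>i\<close>; prime avoidance and the incomparability of the \<open>q\<^sub>i\<close> force
  \<open>q\<^sub>i = p\<^sub>i[S]\<close>, so the \<open>p\<^sub>i\<close> are incomparable as well.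

  Both McCoy's theorem and the primality of \<open>P[S]\<close> are leading-term arguments. They use of \<open>S\<close> only
  that among the sums of two finite sets some sum is attained exactly once. A cancellative torsion-free
  monoid has this property because it carries a translation-invariant total order, for which the sum
  of the two maxima is such a sum (\<open>unique_sums_if_torsion_free\<close>).
\<close>

section \<open>Unique sums in cancellative torsion-free monoids\<close>

text \<open>
  This is the unique product property of group theory, in additive notation. Being a property of the
  whole type, it takes the type as its argument.
\<close>

definition unique_sums :: "'s::comm_monoid_add itself \<Rightarrow> bool" where
  "unique_sums _ \<longleftrightarrow> (\<forall>A B :: 's set. finite A \<longrightarrow> A \<noteq> {} \<longrightarrow> finite B \<longrightarrow> B \<noteq> {} \<longrightarrow>
     (\<exists>s\<in>A. \<exists>t\<in>B. \<forall>s'\<in>A. \<forall>t'\<in>B. s' + t' = s + t \<longrightarrow> s' = s \<and> t' = t))"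

text \<open>
  A partial order on \<open>S\<close>, where \<open>(a, b) \<in> P\<close> is read as \<open>a \<le> b\<close>: the pairs are the formal differences
  \<open>b - a\<close>, and the conditions say that these differences form a positive cone in the group of
  differences of \<open>S\<close>. Closure under sums and cancellation together imply transitivity.
\<close>

definition order_cone :: "('s::comm_monoid_add \<times> 's) set \<Rightarrow> bool" where
  "order_cone P \<longleftrightarrow>
     (\<forall>a. (a, a) \<in> P) \<and>
     (\<forall>a b c d. (a, b) \<in> P \<longrightarrow> (c, d) \<in> P \<longrightarrow> (a + c, b + d) \<in> P) \<and>
     (\<forall>a b c. (a + c, b + c) \<in> P \<longrightarrow> (a, b) \<in> P) \<and>
     (\<forall>a b. (a, b) \<in> P \<longrightarrow> (b, a) \<in> P \<longrightarrow> a = b)"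

lemma
  assumes "order_cone P"
  shows order_cone_refl: "(a, a) \<in> P"
    and order_cone_add: "(a, b) \<in> P \<Longrightarrow> (c, d) \<in> P \<Longrightarrow> (a + c, b + d) \<in> P"
    and order_cone_cancel: "(a + c, b + c) \<in> P \<Longrightarrow> (a, b) \<in> P"
    and order_cone_antisym: "(a, b) \<in> P \<Longrightarrow> (b, a) \<in> P \<Longrightarrow> a = b"
  using assms unfolding order_cone_def by blast+

lemma sum_const_lessThan_add:
  fixes s :: "'s::comm_monoid_add" and k l :: nat
  shows "(\<Sum>i<k + l. s) = (\<Sum>i<k. s) + (\<Sum>i<l. s)"
  by (induction l) (simp_all add: add_ac)

lemma order_cone_sum:
  assumes "order_cone P" "(a, b) \<in> P"
  shows "((\<Sum>i<(k::nat). a), (\<Sum>i<k. b)) \<in> P"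
  by (induction k) (simp_all add: order_cone_refl[OF assms(1)] order_cone_add[OF assms(1)] assms(2))

lemma order_cone_trans:
  assumes P: "order_cone P" and "(a, b) \<in> P" "(b, c) \<in> P"
  shows "(a, c) \<in> P"
proof -
  have "(a + b, c + b) \<in> P"
    using order_cone_add[OF P assms(2,3)] by (simp add: add.commute)
  then show ?thesis by (rule order_cone_cancel[OF P])
qed

text \<open>
  If \<open>x \<le> y\<close> cannot be added to a maximal cone, the reason must be that a multiple of the opposite
  inequality holds already: in the cone generated by \<open>P\<close> and \<open>y - x\<close> some nonzero difference and its
  negative both occur, and adding the two witnesses leaves only a positive multiple of \<open>x - y\<close> in \<open>P\<close>.
\<close>

lemma order_cone_extend:
  fixes x y :: "'s::comm_monoid_add"
  assumes P: "order_cone P"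
    and maximal: "\<And>Q. order_cone Q \<Longrightarrow> P \<subseteq> Q \<Longrightarrow> Q = P"
    and cancel: "\<And>s t u :: 's. s + t = s + u \<Longrightarrow> t = u"
    and xy: "(x, y) \<notin> P"
  obtains k :: nat where "k \<ge> 1" "((\<Sum>i<k. y), (\<Sum>i<k. x)) \<in> P"
proof -
  \<comment> \<open>The cone generated by P and y - x: the difference b - a is in it if subtracting
    a multiple of y - x from it leads into P.\<close>
  define Q where "Q = {(a, b). \<exists>k::nat. (a + (\<Sum>i<k. y), b + (\<Sum>i<k. x)) \<in> P}"
  have PQ: "P \<subseteq> Q"
  proof (clarify)
    fix a b assume "(a, b) \<in> P"
    then have "(a + (\<Sum>i<(0::nat). y), b + (\<Sum>i<(0::nat). x)) \<in> P" by simp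
    then show "(a, b) \<in> Q" unfolding Q_def by blast
  qed
  have "(x + (\<Sum>i<(1::nat). y), y + (\<Sum>i<(1::nat). x)) \<in> P"
    using order_cone_refl[OF P, of "x + y"] by (simp add: add.commute)
  then have "(x, y) \<in> Q" unfolding Q_def by blast
  then have "\<not> order_cone Q" using maximal[OF _ PQ] xy by blast
  moreover have "(a, a) \<in> Q" for a using PQ order_cone_refl[OF P] by blast
  moreover have "(a + c, b + d) \<in> Q" if ab: "(a, b) \<in> Q" and cd: "(c, d) \<in> Q" for a b c d
  proof -
    obtain k where k: "(a + (\<Sum>i<(k::nat). y), b + (\<Sum>i<k. x)) \<in> P" using ab unfolding Q_def by blast
    obtain l where l: "(c + (\<Sum>i<(l::nat). y), d + (\<Sum>i<l. x)) \<in> P" using cd unfolding Q_def by blast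
    have "((a + c) + (\<Sum>i<k + l. y), (b + d) + (\<Sum>i<k + l. x)) \<in> P"
      using order_cone_add[OF P k l] by (simp add: sum_const_lessThan_add add_ac)
    then show ?thesis unfolding Q_def by blast
  qed
  moreover have "(a, b) \<in> Q" if abc: "(a + c, b + c) \<in> Q" for a b c
  proof -
    obtain k where k: "((a + c) + (\<Sum>i<(k::nat). y), (b + c) + (\<Sum>i<k. x)) \<in> P"
      using abc unfolding Q_def by blast
    have "(a + (\<Sum>i<k. y), b + (\<Sum>i<k. x)) \<in> P"
      using order_cone_cancel[OF P, of "a + (\<Sum>i<k. y)" c "b + (\<Sum>i<k. x)"] k
      by (simp add: add_ac)
    then show ?thesis unfolding Q_def by blast
  qed
  ultimately obtain a b where ab: "(a, b) \<in> Q" "(b, a) \<in> Q" "a \<noteq> b"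
    unfolding order_cone_def by blast
  obtain k where k: "(a + (\<Sum>i<(k::nat). y), b + (\<Sum>i<k. x)) \<in> P" using ab(1) unfolding Q_def by blast
  obtain l where l: "(b + (\<Sum>i<(l::nat). y), a + (\<Sum>i<l. x)) \<in> P" using ab(2) unfolding Q_def by blast
  have "((\<Sum>i<k + l. y) + (a + b), (\<Sum>i<k + l. x) + (a + b)) \<in> P"
    using order_cone_add[OF P k l] by (simp add: sum_const_lessThan_add add_ac)
  then have kl: "((\<Sum>i<k + l. y), (\<Sum>i<k + l. x)) \<in> P"
    by (rule order_cone_cancel[OF P])
  \<comment> \<open>If k = l = 0, then a and b would be comparable in both directions already in P.\<close>
  have "k + l \<ge> 1"
  proof (rule ccontr)
    assume "\<not> k + l \<ge> 1"
    then have "k = 0" "l = 0" by simp_all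
    then show False using k l ab(3) order_cone_antisym[OF P, of a b] by simp
  qed
  with kl show thesis by (rule that[rotated])
qed

text \<open>
  By Zorn's lemma the discrete order extends to a maximal cone. If \<open>x\<close> and \<open>y\<close> were incomparable, then
  \<open>k y \<le> k x\<close> and \<open>l x \<le> l y\<close> with positive \<open>k\<close> and \<open>l\<close>, so \<open>l k y = l k x\<close> and torsion-freeness gives \<open>x = y\<close>.
\<close>

lemma exists_total_order_cone:
  assumes cancel: "\<And>s t u :: 's::comm_monoid_add. s + t = s + u \<Longrightarrow> t = u"
    and torsion_free: "\<And>(k::nat) (s::'s) t. k \<ge> 1 \<Longrightarrow> (\<Sum>i<k. s) = (\<Sum>i<k. t) \<Longrightarrow> s = t"
  shows "\<exists>P :: ('s \<times> 's) set. order_cone P \<and> (\<forall>x y. (x, y) \<in> P \<or> (y, x) \<in> P)"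
proof -
  have "\<exists>M\<in>Collect order_cone. \<forall>X\<in>Collect (order_cone :: ('s \<times> 's) set \<Rightarrow> bool). M \<subseteq> X \<longrightarrow> X = M"
  proof (rule subset_Zorn_nonempty)
    have "order_cone (Id :: ('s \<times> 's) set)"
      unfolding order_cone_def using cancel by (auto simp: add.commute)
    then show "Collect (order_cone :: ('s \<times> 's) set \<Rightarrow> bool) \<noteq> {}" by blast
  next
    fix C :: "('s \<times> 's) set set"
    assume ne: "C \<noteq> {}" and chain: "subset.chain (Collect order_cone) C"
    have cone: "order_cone X" if "X \<in> C" for X
      using chain that unfolding subset.chain_def by blast
    have common: "\<exists>X\<in>C. p \<in> X \<and> q \<in> X" if "p \<in> \<Union>C" "q \<in> \<Union>C" for p q
      using chain that unfolding subset_chain_def by blast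
    show "\<Union>C \<in> Collect order_cone"
      unfolding mem_Collect_eq order_cone_def
    proof (intro conjI allI impI)
      show "(a, a) \<in> \<Union>C" for a using ne cone order_cone_refl by blast
      show "(a + c, b + d) \<in> \<Union>C" if "(a, b) \<in> \<Union>C" "(c, d) \<in> \<Union>C" for a b c d
        using common[OF that] cone order_cone_add by blast
      show "(a, b) \<in> \<Union>C" if "(a + c, b + c) \<in> \<Union>C" for a b c
        using that cone order_cone_cancel by blast
      show "a = b" if "(a, b) \<in> \<Union>C" "(b, a) \<in> \<Union>C" for a b
        using common[OF that] cone order_cone_antisym by blast
    qed
  qed
  then obtain P :: "('s \<times> 's) set" where P: "order_cone P"
    and maximal: "\<And>Q. order_cone Q \<Longrightarrow> P \<subseteq> Q \<Longrightarrow> Q = P" by blast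
  have "(x, y) \<in> P \<or> (y, x) \<in> P" for x y
  proof (rule ccontr)
    assume "\<not> ?thesis"
    then have xy: "(x, y) \<notin> P" and yx: "(y, x) \<notin> P" by auto
    obtain k :: nat where k: "k \<ge> 1" "((\<Sum>i<k. y), (\<Sum>i<k. x)) \<in> P"
      by (rule order_cone_extend[OF P _ _ xy]) (erule (1) maximal, erule cancel, blast)
    obtain l :: nat where l: "l \<ge> 1" "((\<Sum>i<l. x), (\<Sum>i<l. y)) \<in> P"
      by (rule order_cone_extend[OF P _ _ yx]) (erule (1) maximal, erule cancel, blast)
    have "((\<Sum>j<l. \<Sum>i<k. y), (\<Sum>j<l. \<Sum>i<k. x)) \<in> P"
      by (rule order_cone_sum[OF P k(2)])
    moreover have "((\<Sum>j<l. \<Sum>i<k. x), (\<Sum>j<l. \<Sum>i<k. y)) \<in> P"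
      using order_cone_sum[OF P l(2), of k]
      by (subst (1 2) sum.swap)
    ultimately have "(\<Sum>j<l. \<Sum>i<k. y) = (\<Sum>j<l. \<Sum>i<k. x)"
      by (rule order_cone_antisym[OF P])
    then have "(\<Sum>i<k. y) = (\<Sum>i<k. x)" by (rule torsion_free[OF l(1)])
    then have "y = x" by (rule torsion_free[OF k(1)])
    then show False using xy order_cone_refl[OF P] by blast
  qed
  with P show ?thesis by blast
qed

lemma order_cone_finite_max:
  assumes P: "order_cone P" and total: "\<And>x y. (x, y) \<in> P \<or> (y, x) \<in> P"
    and "finite A" "A \<noteq> {}"
  shows "\<exists>m\<in>A. \<forall>a\<in>A. (a, m) \<in> P"
  using assms(3,4)
proof (induction rule: finite_ne_induct)
  case (singleton x)
  then show ?case using order_cone_refl[OF P] by blast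
next
  case (insert x F)
  then obtain m where m: "m \<in> F" "\<forall>a\<in>F. (a, m) \<in> P" by blast
  show ?case
  proof (cases "(x, m) \<in> P")
    case True
    then show ?thesis using m by blast
  next
    case False
    then have "(m, x) \<in> P" using total by blast
    then have "\<forall>a\<in>F. (a, x) \<in> P" using m(2) order_cone_trans[OF P] by blast
    then show ?thesis using order_cone_refl[OF P] by blast
  qed
qed

text \<open>
  For a translation-invariant total order, the sum of the two maxima is attained only by the maxima.
\<close>

lemma unique_sums_if_torsion_free:
  assumes cancel: "\<And>s t u :: 's::comm_monoid_add. s + t = s + u \<Longrightarrow> t = u"
    and torsion_free: "\<And>(k::nat) (s::'s) t. k \<ge> 1 \<Longrightarrow> (\<Sum>i<k. s) = (\<Sum>i<k. t) \<Longrightarrow> s = t"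
  shows "unique_sums TYPE('s)"
  unfolding unique_sums_def
proof (intro allI impI)
  fix A B :: "'s set"
  assume AB: "finite A" "A \<noteq> {}" "finite B" "B \<noteq> {}"
  have "\<exists>P :: ('s \<times> 's) set. order_cone P \<and> (\<forall>x y. (x, y) \<in> P \<or> (y, x) \<in> P)"
    by (rule exists_total_order_cone) (erule cancel, erule (1) torsion_free)
  then obtain P :: "('s \<times> 's) set" where P: "order_cone P"
    and total: "\<And>x y. (x, y) \<in> P \<or> (y, x) \<in> P" by blast
  obtain s where s: "s \<in> A" "\<forall>a\<in>A. (a, s) \<in> P"
    using order_cone_finite_max[OF P total AB(1,2)] by blast
  obtain t where t: "t \<in> B" "\<forall>b\<in>B. (b, t) \<in> P"
    using order_cone_finite_max[OF P total AB(3,4)] by blast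
  have "s' = s \<and> t' = t" if st: "s' \<in> A" "t' \<in> B" "s' + t' = s + t" for s' t'
  proof -
    have "(s' + t', s' + t) \<in> P"
      using t(2) st(2) order_cone_refl[OF P] order_cone_add[OF P] by blast
    then have "(s, s') \<in> P" using st(3) order_cone_cancel[OF P] by simp
    then have "s' = s" using s(2) st(1) order_cone_antisym[OF P] by blast
    then show ?thesis using st(3) cancel[of s t' t] by simp
  qed
  then show "\<exists>s\<in>A. \<exists>t\<in>B. \<forall>s'\<in>A. \<forall>t'\<in>B. s' + t' = s + t \<longrightarrow> s' = s \<and> t' = t"
    using s(1) t(1) by blast
qed

text \<open>
  The multiples of any nonzero element are pairwise distinct.
\<close>

lemma infinite_if_torsion_free:
  assumes cancel: "\<And>s t u :: 's::comm_monoid_add. s + t = s + u \<Longrightarrow> t = u"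
    and torsion_free: "\<And>(k::nat) (s::'s) t. k \<ge> 1 \<Longrightarrow> (\<Sum>i<k. s) = (\<Sum>i<k. t) \<Longrightarrow> s = t"
    and nontrivial: "\<exists>s::'s. s \<noteq> 0"
  shows "infinite (UNIV :: 's set)"
proof -
  obtain s :: 's where s: "s \<noteq> 0" using nontrivial by blast
  have "(\<Sum>i<k. s) \<noteq> (\<Sum>i<l. s)" if "k < l" for k l :: nat
  proof
    assume eq: "(\<Sum>i<k. s) = (\<Sum>i<l. s)"
    have "(\<Sum>i<l. s) = (\<Sum>i<k. s) + (\<Sum>i<l - k. s)"
      using that sum_const_lessThan_add[of s k "l - k"] by simp
    then have "0 = (\<Sum>i<l - k. s)"
      using eq cancel[of "\<Sum>i<k. s" 0 "\<Sum>i<l - k. s"] by simp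
    then have "s = 0" using torsion_free[of "l - k" s 0] that by simp
    then show False using s by blast
  qed
  then have "inj (\<lambda>k::nat. \<Sum>i<k. s)"
    by (intro injI) (metis linorder_neqE_nat)
  then show ?thesis
    using infinite_iff_countable_subset by blast
qed

section \<open>Ideals and prime avoidance\<close>

lemma is_ideal_zero: "is_ideal I \<Longrightarrow> 0 \<in> I"
  and is_ideal_diff: "is_ideal I \<Longrightarrow> x \<in> I \<Longrightarrow> y \<in> I \<Longrightarrow> x - y \<in> I"
  and is_ideal_mult_left: "is_ideal I \<Longrightarrow> x \<in> I \<Longrightarrow> a * x \<in> I"
  by (simp_all add: is_ideal_def)

lemma is_ideal_mult_right: "is_ideal I \<Longrightarrow> x \<in> I \<Longrightarrow> x * a \<in> I"
  by (metis is_ideal_mult_left mult.commute)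

lemma is_ideal_add: "is_ideal I \<Longrightarrow> x \<in> I \<Longrightarrow> y \<in> I \<Longrightarrow> x + y \<in> I"
  using is_ideal_diff[of I x "0 - y"] is_ideal_diff[of I 0 y] is_ideal_zero[of I] by simp

lemma is_ideal_sum: "is_ideal I \<Longrightarrow> (\<And>i. i \<in> K \<Longrightarrow> f i \<in> I) \<Longrightarrow> sum f K \<in> I"
  by (induction K rule: infinite_finite_induct) (auto simp: is_ideal_zero is_ideal_add)

lemma is_ideal_hull: "is_ideal (is_ideal hull F)"
  by (rule hull_in) (auto simp: is_ideal_def)

lemma is_prime_ideal_is_ideal: "is_prime_ideal P \<Longrightarrow> is_ideal P"
  and is_prime_ideal_neq_UNIV: "is_prime_ideal P \<Longrightarrow> P \<noteq> UNIV"
  and is_prime_idealD: "is_prime_ideal P \<Longrightarrow> a * b \<in> P \<Longrightarrow> a \<in> P \<or> b \<in> P"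
  by (simp_all add: is_prime_ideal_def)

text \<open>
  A product of elements outside a prime ideal stays outside of it, and it lies in every ideal that
  contains one of its factors.
\<close>

lemma is_ideal_inter_not_subset_prime:
  assumes "finite K" "is_ideal I" "is_prime_ideal P" "\<not> I \<subseteq> P"
    and "\<And>j. j \<in> K \<Longrightarrow> is_ideal (p j)" "\<And>j. j \<in> K \<Longrightarrow> \<not> p j \<subseteq> P"
  shows "\<exists>y\<in>I. (\<forall>j\<in>K. y \<in> p j) \<and> y \<notin> P"
  using assms(1,5,6)
proof (induction rule: finite_induct)
  case empty
  then show ?case using assms(4) by blast
next
  case (insert k K)
  then obtain y where y: "y \<in> I" "\<forall>j\<in>K. y \<in> p j" "y \<notin> P" by auto
  obtain z where z: "z \<in> p k" "z \<notin> P" using insert.prems by blast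
  have "z * y \<in> I" using y(1) assms(2) is_ideal_mult_left by blast
  moreover have "\<forall>j\<in>insert k K. z * y \<in> p j"
    using y z insert.prems(1) by (auto simp: is_ideal_mult_left is_ideal_mult_right)
  moreover have "z * y \<notin> P" using y z is_prime_idealD[OF assms(3)] by blast
  ultimately show ?case by blast
qed

text \<open>
  The class \<open>comm_ring\<close> has no identity element, so the argument has to do without empty products. If
  \<open>I\<close> lies in none of the primes, induction on the index set yields an element of \<open>I\<close> outside all
  of them: a prime contained in another one can be dropped, and for incomparable primes an element
  outside all but \<open>p k\<close> is corrected, if it lies in \<open>p k\<close>, by an element of \<open>I\<close> that lies in all of
  them except \<open>p k\<close>.
\<close>

lemma prime_avoidance:
  assumes "I \<subseteq> (\<Union>k\<in>K. p k)"
    and "finite K" "is_ideal I" "\<And>k. k \<in> K \<Longrightarrow> is_prime_ideal (p k)"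
  shows "\<exists>k\<in>K. I \<subseteq> p k"
proof -
  have "\<exists>x\<in>I. \<forall>k\<in>K. x \<notin> p k" if "\<And>k. k \<in> K \<Longrightarrow> \<not> I \<subseteq> p k"
    using assms(2,4) that
  proof (induction rule: finite_psubset_induct)
    case (psubset K)
    show ?case
    proof (cases "\<exists>k\<in>K. \<exists>j\<in>K. j \<noteq> k \<and> p j \<subseteq> p k")
      case True
      then obtain k j where kj: "k \<in> K" "j \<in> K" "j \<noteq> k" "p j \<subseteq> p k" by blast
      obtain x where "x \<in> I" "\<forall>i\<in>K - {j}. x \<notin> p i"
        using psubset.IH[of "K - {j}"] psubset.prems kj(2) by auto
      then show ?thesis using kj by blast
    next
      case incomparable: False
      show ?thesis
      proof (cases "K = {}")
        case True
        then show ?thesis using is_ideal_zero[OF assms(3)] by blast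
      next
        case False
        then obtain k where k: "k \<in> K" by blast
        obtain x where x: "x \<in> I" "\<forall>i\<in>K - {k}. x \<notin> p i"
          using psubset.IH[of "K - {k}"] psubset.prems k by auto
        obtain y where y: "y \<in> I" "\<forall>i\<in>K - {k}. y \<in> p i" "y \<notin> p k"
          using is_ideal_inter_not_subset_prime[of "K - {k}" I "p k" p]
            psubset.hyps psubset.prems assms(3) k incomparable is_prime_ideal_is_ideal by blast
        show ?thesis
        proof (cases "x \<in> p k")
          case False
          then show ?thesis using x by blast
        next
          case True
          have "x + y \<notin> p k"
            using y(3) True is_ideal_diff[of "p k" "x + y" x] is_prime_ideal_is_ideal psubset.prems(1) k
            by auto
          moreover have "x + y \<notin> p i" if "i \<in> K - {k}" for i
            using x(2) y(2) that is_ideal_diff[of "p i" "x + y" y]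
              is_prime_ideal_is_ideal psubset.prems(1) by auto
          ultimately show ?thesis
            using is_ideal_add[OF assms(3) x(1) y(1)] by blast
        qed
      qed
    qed
  qed
  then show ?thesis using assms(1) by blast
qed

section \<open>Extending and contracting prime ideals\<close>

definition ideal_extension :: "'r::comm_ring set \<Rightarrow> ('s::comm_monoid_add \<Rightarrow>\<^sub>0 'r) set" where
  "ideal_extension P = {f. \<forall>s. Poly_Mapping.lookup f s \<in> P}"

definition ideal_contraction :: "('s::comm_monoid_add \<Rightarrow>\<^sub>0 'r::comm_ring) set \<Rightarrow> 'r set" where
  "ideal_contraction Q = {a. Poly_Mapping.single 0 a \<in> Q}"

lemma sum_monomials:
  "(\<Sum>s\<in>Poly_Mapping.keys f. Poly_Mapping.single s (Poly_Mapping.lookup f s)) = f"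
  by (rule poly_mapping_eqI) (simp add: lookup_sum lookup_single when_def in_keys_iff)

text \<open>
  The convolution product as a finite sum over pairs of exponents, from which a single pair can be
  split off.
\<close>

lemma lookup_times:
  fixes f g :: "'s::comm_monoid_add \<Rightarrow>\<^sub>0 'r::comm_ring"
  shows "Poly_Mapping.lookup (f * g) u =
    (\<Sum>(s, t)\<in>Poly_Mapping.keys f \<times> Poly_Mapping.keys g.
       Poly_Mapping.lookup f s * Poly_Mapping.lookup g t when s + t = u)"
proof -
  have "f * g =
    (\<Sum>s\<in>Poly_Mapping.keys f. Poly_Mapping.single s (Poly_Mapping.lookup f s)) *
    (\<Sum>t\<in>Poly_Mapping.keys g. Poly_Mapping.single t (Poly_Mapping.lookup g t))"
    by (simp add: sum_monomials)
  then show ?thesis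
    by (simp add: sum_product mult_single lookup_sum lookup_single sum.cartesian_product
        case_prod_unfold)
qed

lemma ideal_extension_subset_iff:
  assumes "0 \<in> P"
  shows "(ideal_extension P :: ('s::comm_monoid_add \<Rightarrow>\<^sub>0 'r::comm_ring) set) \<subseteq> ideal_extension P'
    \<longleftrightarrow> P \<subseteq> P'"
proof
  assume sub: "(ideal_extension P :: ('s \<Rightarrow>\<^sub>0 'r) set) \<subseteq> ideal_extension P'"
  show "P \<subseteq> P'"
  proof
    fix a assume "a \<in> P"
    then have "(Poly_Mapping.single 0 a :: 's \<Rightarrow>\<^sub>0 'r) \<in> ideal_extension P"
      using assms by (auto simp: ideal_extension_def lookup_single when_def)
    then have "Poly_Mapping.lookup (Poly_Mapping.single 0 a :: 's \<Rightarrow>\<^sub>0 'r) 0 \<in> P'"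
      using sub unfolding ideal_extension_def by blast
    then show "a \<in> P'" by simp
  qed
qed (auto simp: ideal_extension_def)

lemma is_ideal_ideal_extension:
  assumes I: "is_ideal P"
  shows "is_ideal (ideal_extension P :: ('s::comm_monoid_add \<Rightarrow>\<^sub>0 'r::comm_ring) set)"
  unfolding ideal_extension_def
  by (subst is_ideal_def) (auto simp: lookup_minus lookup_times when_def is_ideal_zero[OF I]
      intro!: is_ideal_diff[OF I] is_ideal_sum[OF I] is_ideal_mult_left[OF I])

text \<open>
  Gauss's lemma. Take the exponents of \<open>f\<close> and of \<open>g\<close> at which the coefficient is outside \<open>P\<close>, and a
  sum of two such exponents that occurs only once. The coefficient of \<open>f * g\<close> there is, up to elements
  of \<open>P\<close>, a product of two elements outside \<open>P\<close>.
\<close>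

lemma is_prime_ideal_ideal_extension:
  assumes U: "unique_sums TYPE('s)" and P: "is_prime_ideal P"
  shows "is_prime_ideal (ideal_extension P :: ('s::comm_monoid_add \<Rightarrow>\<^sub>0 'r::comm_ring) set)"
  unfolding is_prime_ideal_def
proof (intro conjI allI impI)
  let ?E = "ideal_extension P :: ('s \<Rightarrow>\<^sub>0 'r) set"
  note I = is_prime_ideal_is_ideal[OF P]
  show "is_ideal ?E" by (rule is_ideal_ideal_extension[OF I])
  obtain c where "c \<notin> P" using is_prime_ideal_neq_UNIV[OF P] by blast
  then have "Poly_Mapping.single 0 c \<notin> ?E"
    by (auto simp: ideal_extension_def intro!: exI[of _ 0])
  then show "?E \<noteq> UNIV" by blast
  fix f g :: "'s \<Rightarrow>\<^sub>0 'r"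
  assume fg: "f * g \<in> ?E"
  show "f \<in> ?E \<or> g \<in> ?E"
  proof (rule ccontr)
    define A where "A = {s. Poly_Mapping.lookup f s \<notin> P}"
    define B where "B = {t. Poly_Mapping.lookup g t \<notin> P}"
    assume "\<not> ?thesis"
    then have ne: "A \<noteq> {}" "B \<noteq> {}" unfolding A_def B_def ideal_extension_def by auto
    have sub: "A \<subseteq> Poly_Mapping.keys f" "B \<subseteq> Poly_Mapping.keys g"
      unfolding A_def B_def using is_ideal_zero[OF I] by (auto simp: in_keys_iff)
    then have "finite A" "finite B" by (auto intro: finite_subset)
    then obtain s t where st: "s \<in> A" "t \<in> B"
      and unique: "\<And>s' t'. s' \<in> A \<Longrightarrow> t' \<in> B \<Longrightarrow> s' + t' = s + t \<Longrightarrow> s' = s \<and> t' = t"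
      using U ne unfolding unique_sums_def by metis
    let ?K = "Poly_Mapping.keys f \<times> Poly_Mapping.keys g"
    let ?h = "\<lambda>(s', t'). Poly_Mapping.lookup f s' * Poly_Mapping.lookup g t' when s' + t' = s + t"
    have "?h (s', t') \<in> P" if "(s', t') \<noteq> (s, t)" for s' t'
    proof (cases "s' + t' = s + t")
      case True
      then have "s' \<notin> A \<or> t' \<notin> B" using that unique by blast
      then show ?thesis
        using True is_ideal_mult_left[OF I] is_ideal_mult_right[OF I] by (auto simp: A_def B_def)
    qed (simp add: is_ideal_zero[OF I])
    then have "?h x \<in> P" if "x \<in> ?K - {(s, t)}" for x using that by (cases x) blast
    then have "sum ?h (?K - {(s, t)}) \<in> P" by (rule is_ideal_sum[OF I])
    moreover have "sum ?h ?K = ?h (s, t) + sum ?h (?K - {(s, t)})"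
      using st sub by (intro sum.remove) auto
    moreover have "sum ?h ?K \<in> P"
      using fg unfolding ideal_extension_def lookup_times[symmetric] by blast
    ultimately have "?h (s, t) \<in> P"
      using is_ideal_diff[OF I, of "sum ?h ?K" "sum ?h (?K - {(s, t)})"] by simp
    then show False using st is_prime_idealD[OF P] unfolding A_def B_def by auto
  qed
qed

lemma single_in_ideal:
  fixes Q :: "('s::comm_monoid_add \<Rightarrow>\<^sub>0 'r::{comm_ring, comm_monoid_mult}) set"
  assumes "is_ideal Q" "a \<in> ideal_contraction Q"
  shows "Poly_Mapping.single s a \<in> Q"
  using is_ideal_mult_left[OF assms(1), of "Poly_Mapping.single 0 a" "Poly_Mapping.single s 1"] assms(2)
  by (simp add: mult_single ideal_contraction_def)

lemma ideal_extension_contraction_subset: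
  fixes Q :: "('s::comm_monoid_add \<Rightarrow>\<^sub>0 'r::{comm_ring, comm_monoid_mult}) set"
  assumes "is_ideal Q"
  shows "ideal_extension (ideal_contraction Q) \<subseteq> Q"
proof
  fix f :: "'s \<Rightarrow>\<^sub>0 'r"
  assume f: "f \<in> ideal_extension (ideal_contraction Q)"
  have "(\<Sum>s\<in>Poly_Mapping.keys f. Poly_Mapping.single s (Poly_Mapping.lookup f s)) \<in> Q"
    using f by (intro is_ideal_sum[OF assms] single_in_ideal[OF assms]) (simp add: ideal_extension_def)
  then show "f \<in> Q" by (simp add: sum_monomials)
qed

lemma is_prime_ideal_contraction:
  fixes Q :: "('s::comm_monoid_add \<Rightarrow>\<^sub>0 'r::{comm_ring, comm_monoid_mult}) set"
  assumes Q: "is_prime_ideal Q"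
  shows "is_prime_ideal (ideal_contraction Q)"
proof -
  note I = is_prime_ideal_is_ideal[OF Q]
  have mult: "(Poly_Mapping.single 0 (a * b) :: 's \<Rightarrow>\<^sub>0 'r) =
      Poly_Mapping.single 0 a * Poly_Mapping.single 0 b" for a b
    by (simp add: mult_single)
  have "is_ideal (ideal_contraction Q)"
    unfolding is_ideal_def ideal_contraction_def
    by (auto simp: single_diff mult is_ideal_zero[OF I] is_ideal_diff[OF I] is_ideal_mult_left[OF I])
  moreover have "ideal_contraction Q \<noteq> UNIV"
  proof
    assume "ideal_contraction Q = UNIV"
    then have "ideal_extension (ideal_contraction Q) = (UNIV :: ('s \<Rightarrow>\<^sub>0 'r) set)"
      by (simp add: ideal_extension_def)
    then show False
      using ideal_extension_contraction_subset[OF I] is_prime_ideal_neq_UNIV[OF Q] by blast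
  qed
  ultimately show ?thesis
    unfolding is_prime_ideal_def using is_prime_idealD[OF Q]
    by (auto simp: ideal_contraction_def mult)
qed

section \<open>Zero-divisors of the semigroup module\<close>

context unital_module
begin

lemma scale_sum_right: "scale a (sum f K) = (\<Sum>i\<in>K. scale a (f i))"
  by (induction K rule: infinite_finite_induct) (simp_all add: scale_right_distrib)

lemma scale_diff_left: "scale (a - b) x = scale a x - scale b x"
  using scale_left_distrib[of "a - b" b x] by (simp add: algebra_simps)

lemma is_ideal_annihilator: "is_ideal {a. scale a x = 0}"
  unfolding is_ideal_def by (auto simp: scale_diff_left simp flip: scale_scale)

lemma scale_ideal_hull_eq_0:
  assumes "\<And>a. a \<in> F \<Longrightarrow> scale a x = 0" "a \<in> is_ideal hull F"
  shows "scale a x = 0"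
  using hull_minimal[of F "{a. scale a x = 0}" is_ideal] is_ideal_annihilator assms by blast

lemma lookup_semigroup_scale:
  assumes "finite B" "Poly_Mapping.keys g \<subseteq> B"
  shows "Poly_Mapping.lookup (semigroup_scale scale f g) u =
    (\<Sum>(s, t)\<in>Poly_Mapping.keys f \<times> B.
       scale (Poly_Mapping.lookup f s) (Poly_Mapping.lookup g t) when s + t = u)"
  using assms
  by (simp add: semigroup_scale_superset[of "Poly_Mapping.keys f" _ B] lookup_sum lookup_single
      sum.cartesian_product case_prod_unfold)

lemma lookup_map_scale:
  "Poly_Mapping.lookup (Poly_Mapping.map (scale a) g) t = scale a (Poly_Mapping.lookup g t)"
  by (simp add: Poly_Mapping.map.rep_eq when_def)

lemma semigroup_scale_map_scale:
  assumes "semigroup_scale scale f g = 0"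
  shows "semigroup_scale scale f (Poly_Mapping.map (scale a) g) = 0"
proof (rule poly_mapping_eqI)
  fix u
  have "Poly_Mapping.keys (Poly_Mapping.map (scale a) g) \<subseteq> Poly_Mapping.keys g"
    by (auto simp: in_keys_iff lookup_map_scale)
  then have "Poly_Mapping.lookup (semigroup_scale scale f (Poly_Mapping.map (scale a) g)) u =
      scale a (Poly_Mapping.lookup (semigroup_scale scale f g) u)"
    by (auto simp: lookup_semigroup_scale[of "Poly_Mapping.keys g"] lookup_map_scale scale_sum_right
        when_def scale_scale mult.commute intro!: sum.cong)
  then show "Poly_Mapping.lookup (semigroup_scale scale f (Poly_Mapping.map (scale a) g)) u =
      Poly_Mapping.lookup 0 u"
    using assms by simp
qed

text \<open>
  By induction on the number of terms of \<open>g\<close>. If every coefficient of \<open>f\<close> kills \<open>g\<close>, any nonzero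
  coefficient of \<open>g\<close> serves as \<open>x\<close>. Otherwise consider the exponents of \<open>f\<close> whose coefficient does not
  kill \<open>g\<close>: a unique sum with the exponents of \<open>g\<close> shows that some such coefficient \<open>a\<close> kills one of
  the coefficients of \<open>g\<close>. Hence \<open>a g\<close> is nonzero, has fewer terms, and is still annihilated by \<open>f\<close>
  because \<open>R\<close> is commutative.
\<close>

lemma mccoy:
  fixes f :: "'s::comm_monoid_add \<Rightarrow>\<^sub>0 'a" and g :: "'s \<Rightarrow>\<^sub>0 'm"
  assumes U: "unique_sums TYPE('s)"
    and "semigroup_scale scale f g = 0" "g \<noteq> 0"
  shows "\<exists>x. x \<noteq> 0 \<and> (\<forall>s. scale (Poly_Mapping.lookup f s) x = 0)"
  using assms(2,3)
proof (induction "card (Poly_Mapping.keys g)" arbitrary: g rule: less_induct)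
  case less
  define A where "A = {s. \<exists>t. scale (Poly_Mapping.lookup f s) (Poly_Mapping.lookup g t) \<noteq> 0}"
  have keys_g: "Poly_Mapping.keys g \<noteq> {}" using less.prems(2) by simp
  show ?case
  proof (cases "A = {}")
    case True
    obtain t where "t \<in> Poly_Mapping.keys g" using keys_g by blast
    then have "Poly_Mapping.lookup g t \<noteq> 0" by (simp add: in_keys_iff)
    then show ?thesis using True unfolding A_def by auto
  next
    case False
    have A: "A \<subseteq> Poly_Mapping.keys f" unfolding A_def by (auto simp: in_keys_iff intro: ccontr)
    then have "finite A" by (auto intro: finite_subset)
    then obtain s t where st: "s \<in> A" "t \<in> Poly_Mapping.keys g"
      and unique: "\<And>s' t'. s' \<in> A \<Longrightarrow> t' \<in> Poly_Mapping.keys g \<Longrightarrow> s' + t' = s + t \<Longrightarrow>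
        s' = s \<and> t' = t"
      using U False keys_g finite_keys[of g] unfolding unique_sums_def by metis
    let ?K = "Poly_Mapping.keys f \<times> Poly_Mapping.keys g"
    let ?h = "\<lambda>(s', t'). scale (Poly_Mapping.lookup f s') (Poly_Mapping.lookup g t')
      when s' + t' = s + t"
    have "?h x = 0" if "x \<in> ?K - {(s, t)}" for x
      using that unique by (cases x) (auto simp: when_def A_def)
    then have "sum ?h (?K - {(s, t)}) = 0" by (rule sum.neutral[OF ballI])
    moreover have "sum ?h ?K = ?h (s, t) + sum ?h (?K - {(s, t)})"
      using st A by (intro sum.remove) auto
    moreover have "sum ?h ?K = 0"
      using less.prems(1) lookup_semigroup_scale[of "Poly_Mapping.keys g" g f "s + t"] by simp
    ultimately have cancelled: "scale (Poly_Mapping.lookup f s) (Poly_Mapping.lookup g t) = 0"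
      by simp
    let ?g = "Poly_Mapping.map (scale (Poly_Mapping.lookup f s)) g"
    have "Poly_Mapping.keys ?g \<subset> Poly_Mapping.keys g"
      using st(2) cancelled by (auto simp: in_keys_iff lookup_map_scale)
    then have "card (Poly_Mapping.keys ?g) < card (Poly_Mapping.keys g)"
      by (rule psubset_card_mono[OF finite_keys])
    moreover have "semigroup_scale scale f ?g = 0"
      by (rule semigroup_scale_map_scale[OF less.prems(1)])
    moreover have "?g \<noteq> 0"
    proof
      assume "?g = 0"
      then have "scale (Poly_Mapping.lookup f s) (Poly_Mapping.lookup g t') = 0" for t'
        using lookup_map_scale[of "Poly_Mapping.lookup f s" g t'] by simp
      then show False using st(1) unfolding A_def by blast
    qed
    ultimately show ?thesis by (rule less.hyps)
  qed
qed

lemma zero_divisors_semigroup_scale_iff: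
  fixes f :: "'s::comm_monoid_add \<Rightarrow>\<^sub>0 'a"
  assumes "unique_sums TYPE('s)"
  shows "f \<in> zero_divisors (semigroup_scale scale) \<longleftrightarrow>
    (\<exists>x. x \<noteq> 0 \<and> (\<forall>s. scale (Poly_Mapping.lookup f s) x = 0))"
proof
  assume "f \<in> zero_divisors (semigroup_scale scale)"
  then show "\<exists>x. x \<noteq> 0 \<and> (\<forall>s. scale (Poly_Mapping.lookup f s) x = 0)"
    using mccoy[OF assms] unfolding zero_divisors_def by blast
next
  assume "\<exists>x. x \<noteq> 0 \<and> (\<forall>s. scale (Poly_Mapping.lookup f s) x = 0)"
  then obtain x where x: "x \<noteq> 0" "\<And>s. scale (Poly_Mapping.lookup f s) x = 0" by blast
  have "semigroup_scale scale f (Poly_Mapping.single 0 x) = 0"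
    using x by (simp add: semigroup_scale_def)
  moreover have "Poly_Mapping.single 0 x \<noteq> (0 :: 's \<Rightarrow>\<^sub>0 'm)"
    using x(1) by (metis lookup_single_eq lookup_zero)
  ultimately show "f \<in> zero_divisors (semigroup_scale scale)"
    unfolding zero_divisors_def by blast
qed

text \<open>
  The coefficient criterion applied to constants.
\<close>

lemma zero_divisors_eq_contraction:
  assumes "unique_sums TYPE('s::comm_monoid_add)"
  shows "zero_divisors scale =
    ideal_contraction (zero_divisors
      (semigroup_scale scale :: ('s \<Rightarrow>\<^sub>0 'a) \<Rightarrow> ('s \<Rightarrow>\<^sub>0 'm) \<Rightarrow> ('s \<Rightarrow>\<^sub>0 'm)))"
  unfolding ideal_contraction_def zero_divisors_semigroup_scale_iff[OF assms]
  by (auto simp: zero_divisors_def lookup_single when_def)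

lemma zero_divisors_semigroup_scale:
  assumes U: "unique_sums TYPE('s::comm_monoid_add)" and A: "property_A scale"
    and K: "finite K" and p: "\<And>i. i \<in> K \<Longrightarrow> is_prime_ideal (p i)"
    and Z: "zero_divisors scale = (\<Union>i\<in>K. p i)"
  shows "zero_divisors (semigroup_scale scale :: ('s \<Rightarrow>\<^sub>0 'a) \<Rightarrow> ('s \<Rightarrow>\<^sub>0 'm) \<Rightarrow> ('s \<Rightarrow>\<^sub>0 'm)) =
    (\<Union>i\<in>K. ideal_extension (p i))"
proof (intro set_eqI iffI)
  fix f :: "'s \<Rightarrow>\<^sub>0 'a"
  \<comment> \<open>The added 0 changes no generated ideal; it makes the coefficients at all exponents generators.\<close>
  let ?F = "insert 0 (Poly_Mapping.lookup f ` Poly_Mapping.keys f)"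
  let ?c = "is_ideal hull ?F"
  have coeff: "Poly_Mapping.lookup f s \<in> ?F" for s
    by (cases "s \<in> Poly_Mapping.keys f") (auto simp: in_keys_iff)
  {
    assume "f \<in> zero_divisors (semigroup_scale scale :: _ \<Rightarrow> ('s \<Rightarrow>\<^sub>0 'm) \<Rightarrow> _)"
    then obtain x where x: "x \<noteq> 0" "\<And>s. scale (Poly_Mapping.lookup f s) x = 0"
      using zero_divisors_semigroup_scale_iff[OF U] by blast
    have "scale a x = 0" if "a \<in> ?c" for a
      by (rule scale_ideal_hull_eq_0[OF _ that]) (auto simp: x(2))
    then have "?c \<subseteq> zero_divisors scale"
      using x(1) unfolding zero_divisors_def by blast
    then have "\<exists>i\<in>K. ?c \<subseteq> p i"
      unfolding Z by (rule prime_avoidance[OF _ K is_ideal_hull p])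
    then obtain i where "i \<in> K" "?c \<subseteq> p i" by blast
    then show "f \<in> (\<Union>i\<in>K. ideal_extension (p i))"
      using hull_inc[OF coeff] unfolding ideal_extension_def by blast
  next
    assume "f \<in> (\<Union>i\<in>K. ideal_extension (p i))"
    then obtain i where i: "i \<in> K" "\<And>s. Poly_Mapping.lookup f s \<in> p i"
      unfolding ideal_extension_def by blast
    have I: "is_ideal (p i)" using p[OF i(1)] is_prime_ideal_is_ideal by blast
    have "?c \<subseteq> p i"
      by (rule hull_minimal) (auto simp: i(2) is_ideal_zero[OF I] I)
    then have "?c \<subseteq> zero_divisors scale" using i(1) Z by blast
    moreover have "is_fg_ideal ?c" unfolding is_fg_ideal_def by (rule exI[of _ ?F]) simp
    ultimately obtain x where "x \<noteq> 0" "\<forall>a\<in>?c. scale a x = 0"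
      using A unfolding property_A_def by blast
    then show "f \<in> zero_divisors (semigroup_scale scale :: _ \<Rightarrow> ('s \<Rightarrow>\<^sub>0 'm) \<Rightarrow> _)"
      unfolding zero_divisors_semigroup_scale_iff[OF U] using hull_inc[OF coeff] by blast
  }
qed

text \<open>
  Prime avoidance puts an ideal of zero-divisors into a single contracted prime. An element of \<open>R[S]\<close>
  that has the generators as its coefficients then lies in the prime itself, so it is a zero-divisor
  and the generators annihilate a common nonzero element.
\<close>

lemma property_A_if_zero_divisors_semigroup_scale:
  assumes U: "unique_sums TYPE('s::comm_monoid_add)" and inf: "infinite (UNIV :: 's set)"
    and K: "finite K" and q: "\<And>i. i \<in> K \<Longrightarrow> is_prime_ideal (q i)"
    and Z: "zero_divisors (semigroup_scale scale :: ('s \<Rightarrow>\<^sub>0 'a) \<Rightarrow> ('s \<Rightarrow>\<^sub>0 'm) \<Rightarrow> ('s \<Rightarrow>\<^sub>0 'm)) =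
      (\<Union>i\<in>K. q i)"
  shows "property_A scale"
  unfolding property_A_def
proof (intro allI impI, elim conjE)
  fix I :: "'a set"
  assume fg: "is_fg_ideal I" and sub: "I \<subseteq> zero_divisors scale"
  obtain F where F: "finite F" "I = is_ideal hull F" using fg unfolding is_fg_ideal_def by blast
  have "zero_divisors scale = (\<Union>i\<in>K. ideal_contraction (q i))"
    unfolding zero_divisors_eq_contraction[OF U] Z by (auto simp: ideal_contraction_def)
  then have "I \<subseteq> (\<Union>i\<in>K. ideal_contraction (q i))" using sub by simp
  then have "\<exists>i\<in>K. I \<subseteq> ideal_contraction (q i)"
    by (rule prime_avoidance[OF _ K])
      (simp_all add: F(2) is_ideal_hull is_prime_ideal_contraction q)
  then obtain i where i: "i \<in> K" "I \<subseteq> ideal_contraction (q i)" by blast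
  \<comment> \<open>Distinct exponents for the generators, so that they do not merge in the sum f.\<close>
  obtain E :: "'s set" where "finite E" "card E = card F"
    using infinite_arbitrarily_large[OF inf] by blast
  then have "\<exists>e. bij_betw e F E" using F(1) by (intro finite_same_card_bij) simp_all
  then obtain e :: "'a \<Rightarrow> 's" where e: "inj_on e F" unfolding bij_betw_def by blast
  define f where "f = (\<Sum>a\<in>F. Poly_Mapping.single (e a) a)"
  have "f \<in> q i"
    unfolding f_def using i hull_subset[of F is_ideal] F(2) is_prime_ideal_is_ideal[OF q[OF i(1)]]
    by (intro is_ideal_sum single_in_ideal) auto
  then obtain x where x: "x \<noteq> 0" "\<And>s. scale (Poly_Mapping.lookup f s) x = 0"
    using Z i(1) zero_divisors_semigroup_scale_iff[OF U] by blast
  have "scale a x = 0" if "a \<in> F" for a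
  proof -
    have "Poly_Mapping.lookup f (e a) = (\<Sum>b\<in>F. b when e b = e a)"
      by (simp add: f_def lookup_sum lookup_single)
    also have "\<dots> = (\<Sum>b\<in>F. if b = a then b else 0)"
      using e that by (intro sum.cong) (auto simp: when_def inj_on_def)
    also have "\<dots> = a" using F(1) that by simp
    finally show ?thesis using x(2)[of "e a"] by simp
  qed
  then show "\<exists>x. x \<noteq> 0 \<and> (\<forall>a\<in>I. scale a x = 0)"
    using x(1) scale_ideal_hull_eq_0[of F x] unfolding F(2) by (intro exI[of _ x]) simp
qed

lemma few_zero_divisors_semigroup_scale:
  assumes U: "unique_sums TYPE('s::comm_monoid_add)"
    and few: "few_zero_divisors scale n" and A: "property_A scale"
  shows "few_zero_divisors
    (semigroup_scale scale :: ('s \<Rightarrow>\<^sub>0 'a) \<Rightarrow> ('s \<Rightarrow>\<^sub>0 'm) \<Rightarrow> ('s \<Rightarrow>\<^sub>0 'm)) n"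
proof -
  obtain p where prime: "\<forall>i\<in>{1..n}. is_prime_ideal (p i)"
    and incomparable: "\<forall>i\<in>{1..n}. \<forall>j\<in>{1..n}. i \<noteq> j \<longrightarrow> \<not> p i \<subseteq> p j"
    and Z: "zero_divisors scale = (\<Union>i\<in>{1..n}. p i)"
    using few unfolding few_zero_divisors_def by (elim exE conjE)
  have p: "is_prime_ideal (p i)" if "i \<in> {1..n}" for i using prime that by blast
  let ?E = "\<lambda>i. ideal_extension (p i) :: ('s \<Rightarrow>\<^sub>0 'a) set"
  have "0 \<in> p i" if "i \<in> {1..n}" for i
    by (rule is_ideal_zero[OF is_prime_ideal_is_ideal[OF p[OF that]]])
  then have "\<forall>i\<in>{1..n}. \<forall>j\<in>{1..n}. i \<noteq> j \<longrightarrow> \<not> ?E i \<subseteq> ?E j"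
    using incomparable by (simp add: ideal_extension_subset_iff)
  moreover have "\<forall>i\<in>{1..n}. is_prime_ideal (?E i)"
    using is_prime_ideal_ideal_extension[OF U p] by blast
  moreover have "zero_divisors (semigroup_scale scale :: _ \<Rightarrow> ('s \<Rightarrow>\<^sub>0 'm) \<Rightarrow> _) = (\<Union>i\<in>{1..n}. ?E i)"
    by (rule zero_divisors_semigroup_scale[OF U A _ p Z]) simp
  ultimately show ?thesis unfolding few_zero_divisors_def by (intro exI[of _ ?E] conjI)
qed

lemma few_zero_divisors_if_semigroup_scale:
  assumes U: "unique_sums TYPE('s::comm_monoid_add)" and inf: "infinite (UNIV :: 's set)"
    and few: "few_zero_divisors
      (semigroup_scale scale :: ('s \<Rightarrow>\<^sub>0 'a) \<Rightarrow> ('s \<Rightarrow>\<^sub>0 'm) \<Rightarrow> ('s \<Rightarrow>\<^sub>0 'm)) n"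
  shows "few_zero_divisors scale n \<and> property_A scale"
proof -
  obtain q where prime: "\<forall>i\<in>{1..n}. is_prime_ideal (q i)"
    and incomparable: "\<forall>i\<in>{1..n}. \<forall>j\<in>{1..n}. i \<noteq> j \<longrightarrow> \<not> q i \<subseteq> q j"
    and Z: "zero_divisors
      (semigroup_scale scale :: ('s \<Rightarrow>\<^sub>0 'a) \<Rightarrow> ('s \<Rightarrow>\<^sub>0 'm) \<Rightarrow> ('s \<Rightarrow>\<^sub>0 'm)) = (\<Union>i\<in>{1..n}. q i)"
    using few unfolding few_zero_divisors_def by (elim exE conjE)
  have q: "is_prime_ideal (q i)" if "i \<in> {1..n}" for i using prime that by blast
  have A: "property_A scale"
    by (rule property_A_if_zero_divisors_semigroup_scale[OF U inf _ q Z]) auto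
  define p where "p i = ideal_contraction (q i)" for i
  have p: "is_prime_ideal (p i)" if "i \<in> {1..n}" for i
    unfolding p_def by (rule is_prime_ideal_contraction[OF q[OF that]])
  have Zp: "zero_divisors scale = (\<Union>i\<in>{1..n}. p i)"
    unfolding zero_divisors_eq_contraction[OF U] Z p_def by (auto simp: ideal_contraction_def)
  have ext: "ideal_extension (p i) \<subseteq> q i" if "i \<in> {1..n}" for i
    unfolding p_def
    by (rule ideal_extension_contraction_subset[OF is_prime_ideal_is_ideal[OF q[OF that]]])
  \<comment> \<open>Prime avoidance gives only some i with q j inside the extension of p i, hence inside q i;
    incomparability then makes i = j.\<close>
  have q_sub: "q j \<subseteq> ideal_extension (p j)" if j: "j \<in> {1..n}" for j
  proof -
    have "q j \<subseteq> (\<Union>i\<in>{1..n}. ideal_extension (p i))"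
      using zero_divisors_semigroup_scale[OF U A _ p Zp] Z j by auto
    then have "\<exists>i\<in>{1..n}. q j \<subseteq> ideal_extension (p i)"
      by (rule prime_avoidance[OF _ _ is_prime_ideal_is_ideal[OF q[OF j]]
          is_prime_ideal_ideal_extension[OF U p]]) simp_all
    then obtain i where i: "i \<in> {1..n}" "q j \<subseteq> ideal_extension (p i)" by blast
    then have "q j \<subseteq> q i" using ext by blast
    then have "i = j" using incomparable[rule_format, OF j i(1)] by blast
    then show ?thesis using i(2) by simp
  qed
  have "\<not> p i \<subseteq> p j" if "i \<in> {1..n}" "j \<in> {1..n}" "i \<noteq> j" for i j
  proof
    assume "p i \<subseteq> p j"
    then have "ideal_extension (p i) \<subseteq> (ideal_extension (p j) :: ('s \<Rightarrow>\<^sub>0 'a) set)"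
      unfolding ideal_extension_def by blast
    then have "q i \<subseteq> q j" using q_sub[OF that(1)] ext[OF that(2)] by blast
    then show False using incomparable[rule_format, OF that] by blast
  qed
  then have "few_zero_divisors scale n"
    unfolding few_zero_divisors_def using p Zp by (intro exI[of _ p] conjI) simp_all
  with A show ?thesis by blast
qed

end

theorem theorem14:
  fixes scale :: "'r::{comm_ring, comm_monoid_mult} \<Rightarrow> 'm::ab_group_add \<Rightarrow> 'm"
    and n :: nat
  assumes "unital_module scale"
    and cancellative: "\<And>s t u :: 's::comm_monoid_add. s + t = s + u \<Longrightarrow> t = u"
    and torsion_free: "\<And>(k::nat) (s::'s) t. k \<ge> 1 \<Longrightarrow> (\<Sum>i<k. s) = (\<Sum>i<k. t) \<Longrightarrow> s = t"
    and nontrivial: "\<exists>s::'s. s \<noteq> 0"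
    and "n \<ge> 1"
  shows "few_zero_divisors
           (semigroup_scale scale :: ('s \<Rightarrow>\<^sub>0 'r) \<Rightarrow> ('s \<Rightarrow>\<^sub>0 'm) \<Rightarrow> ('s \<Rightarrow>\<^sub>0 'm)) n
         \<longleftrightarrow> few_zero_divisors scale n \<and> property_A scale"
proof -
  interpret unital_module scale by fact
  have U: "unique_sums TYPE('s)"
    by (rule unique_sums_if_torsion_free) (erule cancellative, erule (1) torsion_free)
  have inf: "infinite (UNIV :: 's set)"
    by (rule infinite_if_torsion_free[OF _ _ nontrivial]) (erule cancellative, erule (1) torsion_free)
  show ?thesis
    using few_zero_divisors_semigroup_scale[OF U] few_zero_divisors_if_semigroup_scale[OF U inf]
    by blast
qed

end
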